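(* Let $g:[0,\infty)\to\mathbb{R}$ be $g(b)=1+\frac{1-2b}{2}e^{-b}-(b+1)e^{-2b}-\frac12 e^{-3b}$ and let $\alpha=\inf\{b\ge 0: g(b)\ge 1/2\}$. Then for the semi-random graph process, $\tau_{\mathtt{PM}}\ge \alpha\ge 0.93261$.
   Context: Semi-random graph process: start from the empty graph $G_0$ on vertex set $[n]$. In each round $t=1,2,\dots$ a vertex $u_t$ (the "square") is chosen independently and uniformly at random from $[n]$; the player, knowing the history and $u_t$, selects a vertex $v_t$ (the "circle") and the edge $u_tv_t$ is added, giving $G_t$. A strategy specifies, for each $n$ and $t$, a distribution over $[n]$ for $v_t$ depending on $u_1,v_1,\dots,u_{t-1},v_{t-1},u_t$. For a monotone increasing property $\mathcal{P}$, a strategy $\mathcal{S}$ and $0<q<1$, let $\tau_{\mathcal{P}}(\mathcal{S},q,n)$ be the least $t\ge0$ with $\mathbb{P}[G_t\in\mathcal{P}]\ge q$ (or $\infty$), $\tau_{\mathcal{P}}(q,n)=\inf_{\mathcal{S}}\tau_{\mathcal{P}}(\mathcal{S},q,n)$, and $\tau_{\mathcal{P}}=\lim_{q\to1^-}\limsup_{n\to\infty}\tau_{\mathcal{P}}(q,n)/n$. $\mathtt{PM}$ is the property of having a perfect matching (for odd $n$, a matching saturating all but one vertex). *)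

theory Defs
  imports "HOL-Probability.Probability"
begin

text \<open>Vertices are 0..n-1. A history is the list of rounds (u_t, v_t) played so far.
A strategy maps n, the history and the current square u_t to a distribution of v_t.\<close>

type_synonym strategy = "nat \<Rightarrow> (nat \<times> nat) list \<Rightarrow> nat \<Rightarrow> nat pmf"

definition valid_strategy :: "strategy \<Rightarrow> bool" where
  "valid_strategy S \<longleftrightarrow> (\<forall>n h u. 0 < n \<longrightarrow> set_pmf (S n h u) \<subseteq> {..<n})"

fun hist_dist :: "strategy \<Rightarrow> nat \<Rightarrow> nat \<Rightarrow> (nat \<times> nat) list pmf" where
  "hist_dist S n 0 = return_pmf []"
| "hist_dist S n (Suc t) =
     bind_pmf (hist_dist S n t) (\<lambda>h.
     bind_pmf (pmf_of_set {..<n}) (\<lambda>u.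
     bind_pmf (S n h u) (\<lambda>v. return_pmf (h @ [(u, v)]))))"

text \<open>Edge set of the graph G_t built from a history (loops are singletons).\<close>
definition graph_edges :: "(nat \<times> nat) list \<Rightarrow> nat set set" where
  "graph_edges h = {{u, v} | u v. (u, v) \<in> set h}"

text \<open>Perfect matching (for odd n: saturating all but one vertex).\<close>
definition has_PM :: "nat \<Rightarrow> nat set set \<Rightarrow> bool" where
  "has_PM n E \<longleftrightarrow> (\<exists>M \<subseteq> E. (\<forall>e\<in>M. card e = 2) \<and>
      (\<forall>e\<in>M. \<forall>f\<in>M. e \<noteq> f \<longrightarrow> e \<inter> f = {}) \<and>
      \<Union>M \<subseteq> {..<n} \<and> card (\<Union>M) = 2 * (n div 2))"

definition prob_PM :: "strategy \<Rightarrow> nat \<Rightarrow> nat \<Rightarrow> real" where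
  "prob_PM S n t = measure_pmf.prob (hist_dist S n t) {h. has_PM n (graph_edges h)}"

definition tau_S :: "strategy \<Rightarrow> real \<Rightarrow> nat \<Rightarrow> ereal" where
  "tau_S S q n = (if \<exists>t. prob_PM S n t \<ge> q then ereal (real (LEAST t. prob_PM S n t \<ge> q)) else \<infinity>)"

definition tau_qn :: "real \<Rightarrow> nat \<Rightarrow> ereal" where
  "tau_qn q n = (INF S \<in> {S. valid_strategy S}. tau_S S q n)"

definition tau_PM :: ereal where
  "tau_PM = Lim (at_left (1::real)) (\<lambda>q. limsup (\<lambda>n. tau_qn q n / ereal (real n)))"

definition g_fun :: "real \<Rightarrow> real" where
  "g_fun b = 1 + (1 - 2*b)/2 * exp (-b) - (b + 1) * exp (-2*b) - 1/2 * exp (-3*b)"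

definition alpha_PM :: real where
  "alpha_PM = Inf {b. b \<ge> 0 \<and> g_fun b \<ge> 1/2}"

end

theory Submission
  imports Defs
begin

text \<open>
  Orient each edge of a matching from its square to its circle. The tails are distinct, so a perfect
  matching needs about n/2 vertices hit by squares. If x is hit exactly once, with circle y,
  and y is hit later, then x and y cannot both be tails of matching edges. So a tail x of this kind can
  be charged to y instead of itself, except when y itself was hit only once and its circle has been hit
  since. The matching is thus no larger than the number of vertices x that are either hit at least
  twice, or hit once with a circle not hit since, or hit once and in this exceptional situation.
  Squares are uniform whatever the player does, so the probability of each alternative obeys a linear
  recurrence along the rounds; after bn rounds the three probabilities sum to at most
  \<^term>\<open>g_fun b\<close> + o(1). As the threshold only concerns success probabilities q close to 1, Markov's
  inequality suffices: a perfect matching exists with probability at most 2 \<^term>\<open>g_fun b\<close> + o(1), which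
  is bounded away from 1 if \<^term>\<open>g_fun b < 1/2\<close>.
\<close>

section \<open>The status of a vertex\<close>

text \<open>
  All states but \<^term>\<open>Unhit\<close> and \<^term>\<open>Multi\<close> describe a vertex x hit by exactly one square; y is its circle.
  \<^term>\<open>Fresh y\<close>: y has not been hit since. \<^term>\<open>Half y z\<close>: y has been hit once since, with circle z, and
  z has not been hit since then. \<^term>\<open>Closed y\<close>: as before, but z has been hit. \<^term>\<open>Lost y\<close>: y has been
  hit again, or z = x.
\<close>

datatype status = Unhit | Fresh nat | Half nat nat | Closed nat | Lost nat | Multi

fun status_step :: "nat \<Rightarrow> status \<Rightarrow> nat \<times> nat \<Rightarrow> status" where
  "status_step x Unhit (u, v) = (if u = x then Fresh v else Unhit)"
| "status_step x (Fresh y) (u, v) =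
     (if u = x then Multi else if u = y then (if v = x then Lost y else Half y v) else Fresh y)"
| "status_step x (Half y z) (u, v) =
     (if u = x then Multi else if u = y then Lost y else if u = z then Closed y else Half y z)"
| "status_step x (Closed y) (u, v) =
     (if u = x then Multi else if u = y then Lost y else Closed y)"
| "status_step x (Lost y) (u, v) = (if u = x then Multi else Lost y)"
| "status_step x Multi (u, v) = Multi"

definition status :: "nat \<Rightarrow> (nat \<times> nat) list \<Rightarrow> status" where
  "status x h = foldl (status_step x) Unhit h"

lemma status_Nil [simp]: "status x [] = Unhit"
  by (simp add: status_def)

lemma status_snoc [simp]: "status x (h @ [e]) = status_step x (status x h) e"
  by (simp add: status_def)

definition loopless :: "nat \<Rightarrow> (nat \<times> nat) list \<Rightarrow> bool" where
  "loopless n h \<longleftrightarrow> (\<forall>(u, v)\<in>set h. u < n \<and> v < n \<and> u \<noteq> v)"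

lemma loopless_snoc [simp]:
  "loopless n (h @ [(u, v)]) \<longleftrightarrow> loopless n h \<and> u < n \<and> v < n \<and> u \<noteq> v"
  by (auto simp: loopless_def)

text \<open>The states to which a tail is charged.\<close>

fun status_good :: "status \<Rightarrow> bool" where
  "status_good (Fresh y) = True"
| "status_good (Closed y) = True"
| "status_good Multi = True"
| "status_good _ = False"

text \<open>The clauses for \<open>Half\<close> and \<open>Lost\<close> make the circle y a good
  vertex. It was hit after x, so either it had been hit before and is \<open>Multi\<close>, or that
  hit is its only one and its circle has not been hit since. For \<open>Closed\<close>, itself good,
  it is enough to remember that y is not \<open>Unhit\<close>: the next hit on y then makes it
  \<open>Multi\<close>, as \<open>Lost\<close> requires.\<close>

fun status_inv :: "nat \<Rightarrow> nat \<Rightarrow> (nat \<times> nat) list \<Rightarrow> status \<Rightarrow> bool" where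
  "status_inv n x h Unhit = (\<forall>v. (x, v) \<notin> set h)"
| "status_inv n x h (Fresh y) = (y \<noteq> x \<and> y < n \<and> (\<forall>v. (x, v) \<in> set h \<longrightarrow> v = y))"
| "status_inv n x h (Half y z) = (y \<noteq> x \<and> y < n \<and> z < n \<and> z \<noteq> x \<and> z \<noteq> y \<and>
     (\<forall>v. (x, v) \<in> set h \<longrightarrow> v = y) \<and> (status y h = Multi \<or> status y h = Fresh z))"
| "status_inv n x h (Closed y) = (y \<noteq> x \<and> y < n \<and>
     (\<forall>v. (x, v) \<in> set h \<longrightarrow> v = y) \<and> status y h \<noteq> Unhit)"
| "status_inv n x h (Lost y) = (y \<noteq> x \<and> y < n \<and>
     (\<forall>v. (x, v) \<in> set h \<longrightarrow> v = y) \<and> (status y h = Multi \<or> status y h = Fresh x))"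
| "status_inv n x h Multi = True"

lemma status_invariant:
  assumes "loopless n h"
  shows "status_inv n x h (status x h)"
  using assms
proof (induction h arbitrary: x rule: rev_induct)
  case Nil
  then show ?case by simp
next
  case (snoc e h)
  obtain u v where e: "e = (u, v)" by (cases e)
  have IH: "status_inv n z h (status z h)" for z
    using snoc by (simp add: e)
  \<comment> \<open>This settles the new status of y when the square falls on y:
    \<open>Fresh v\<close> on a first hit, \<open>Multi\<close> otherwise.\<close>
  have hit: "status_step u (status u h) (u, v) = (if status u h = Unhit then Fresh v else Multi)"
    by (cases "status u h") simp_all
  have unhit: "status_step z s (u, v) = Unhit \<Longrightarrow> s = Unhit" for z s
    by (cases s) (auto split: if_splits)
  show ?case
    using IH[of x] hit snoc.prems
    by (cases "status x h") (auto simp: e dest: unhit split: if_splits)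
qed

section \<open>Matchings\<close>

lemma matching_card_Union:
  assumes "finite M" "\<forall>e\<in>M. card e = 2" "\<forall>e\<in>M. \<forall>f\<in>M. e \<noteq> f \<longrightarrow> e \<inter> f = {}"
  shows "card (\<Union>M) = 2 * card M"
proof -
  have "card (\<Union>M) = (\<Sum>e\<in>M. card e)"
    using assms by (intro card_Union_disjoint) (auto simp: pairwise_def disjnt_def intro: card_ge_0_finite)
  then show ?thesis using assms by simp
qed

text \<open>Each edge is charged to one of its own endpoints, so disjointness of the edges makes the
  charge injective. A tail that is not good is \<open>Half\<close> or \<open>Lost\<close>, and then
  the invariant makes its circle good.\<close>

lemma card_matching_le_good:
  assumes h: "loopless n h"
    and M: "M \<subseteq> graph_edges h" "\<forall>e\<in>M. \<forall>f\<in>M. e \<noteq> f \<longrightarrow> e \<inter> f = {}"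
  shows "card M \<le> card {x. x < n \<and> status_good (status x h)}"
proof -
  have "\<forall>e\<in>M. \<exists>u v. e = {u, v} \<and> (u, v) \<in> set h"
    using M by (auto simp: graph_edges_def)
  then obtain a b where ab: "\<And>e. e \<in> M \<Longrightarrow> e = {a e, b e} \<and> (a e, b e) \<in> set h"
    by metis
  define f where "f e = (if status_good (status (a e) h) then a e else b e)" for e
  have mem: "f e \<in> e" if "e \<in> M" for e
    using ab[OF that] by (auto simp: f_def)
  have "inj_on f M"
    using M(2) mem by (intro inj_onI) (metis disjoint_iff)
  moreover have "f ` M \<subseteq> {x. x < n \<and> status_good (status x h)}"
  proof
    fix y assume "y \<in> f ` M"
    then obtain e where e: "e \<in> M" "y = f e" by auto
    have "a e < n" "b e < n"
      using ab[OF e(1)] h by (auto simp: loopless_def)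
    moreover have "status_good (status (f e) h)"
      using ab[OF e(1)] status_invariant[OF h, of "a e"]
      by (cases "status (a e) h") (auto simp: f_def)
    ultimately show "y \<in> {x. x < n \<and> status_good (status x h)}"
      by (auto simp: e f_def)
  qed
  ultimately show ?thesis
    by (intro card_inj_on_le) auto
qed

text \<open>
  Loops are useless to the player but would break the invariant; replacing them changes no square,
  so the recurrences are not affected.
\<close>

fun deloop :: "nat \<times> nat \<Rightarrow> nat \<times> nat" where
  "deloop (u, v) = (u, if v = u then (if u = 0 then 1 else 0) else v)"

lemma deloop_loopless:
  assumes "2 \<le> n" "set h \<subseteq> {..<n} \<times> {..<n}"
  shows "loopless n (map deloop h)"
  using assms by (auto simp: loopless_def split: if_splits)

text \<open>Matching edges have two endpoints, so none of them is a loop and all survive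
  \<open>deloop\<close>.\<close>

lemma has_PM_imp_good:
  assumes n: "2 \<le> n" and h: "set h \<subseteq> {..<n} \<times> {..<n}" and PM: "has_PM n (graph_edges h)"
  shows "n div 2 \<le> card {x. x < n \<and> status_good (status x (map deloop h))}"
proof -
  obtain M where M: "M \<subseteq> graph_edges h" "\<forall>e\<in>M. card e = 2"
      "\<forall>e\<in>M. \<forall>f\<in>M. e \<noteq> f \<longrightarrow> e \<inter> f = {}" "card (\<Union>M) = 2 * (n div 2)"
    using PM unfolding has_PM_def by (elim exE conjE) (rule that)
  have "graph_edges h = (\<lambda>(u, v). {u, v}) ` set h"
    by (auto simp: graph_edges_def)
  then have "finite (graph_edges h)"
    by simp
  then have "finite M"
    by (rule finite_subset[OF M(1)])
  then have "card M = n div 2"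
    using matching_card_Union[OF _ M(2,3)] M(4) by simp
  moreover have "M \<subseteq> graph_edges (map deloop h)"
  proof
    fix e assume e: "e \<in> M"
    then obtain u v where uv: "e = {u, v}" "(u, v) \<in> set h"
      using M(1) by (auto simp: graph_edges_def)
    with M(2) e have "u \<noteq> v" by auto
    then have "(u, v) \<in> set (map deloop h)"
      using uv(2) by force
    then show "e \<in> graph_edges (map deloop h)"
      using uv(1) by (auto simp: graph_edges_def)
  qed
  ultimately show ?thesis
    using card_matching_le_good[OF deloop_loopless[OF n h] _ M(3)] by simp
qed

section \<open>One round of the process\<close>

lemma prob_bind_pmf:
  "measure_pmf.prob (bind_pmf M N) A = (\<integral>x. measure_pmf.prob (N x) A \<partial>measure_pmf M)"
proof -
  have "ennreal (measure_pmf.prob (bind_pmf M N) A) = (\<integral>\<^sup>+x. ennreal (measure_pmf.prob (N x) A) \<partial>measure_pmf M)"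
    by (simp flip: measure_pmf.emeasure_eq_measure)
  also have "\<dots> = ennreal (\<integral>x. measure_pmf.prob (N x) A \<partial>measure_pmf M)"
    by (intro nn_integral_eq_integral measure_pmf.integrable_const_bound[where B = 1]) auto
  finally show ?thesis
    by (simp add: integral_nonneg_AE)
qed

lemma hist_dist_in_range:
  assumes "valid_strategy S" "0 < n" "h \<in> set_pmf (hist_dist S n t)"
  shows "set h \<subseteq> {..<n} \<times> {..<n}"
  using assms(3)
proof (induction t arbitrary: h)
  case (Suc t)
  have "set_pmf (pmf_of_set {..<n}) = {..<n}"
    using assms(2) by (intro set_pmf_of_set) auto
  then obtain h' u v where h: "h = h' @ [(u, v)]" "h' \<in> set_pmf (hist_dist S n t)" "u < n"
      "v \<in> set_pmf (S n h' u)"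
    using Suc.prems by auto
  moreover have "v < n"
    using h(4) assms(1,2) unfolding valid_strategy_def by blast
  ultimately show ?case
    using Suc.IH[of h'] by simp
qed simp

lemma prob_hist_dist_Suc:
  assumes "0 < n"
  shows "measure_pmf.prob (hist_dist S n (Suc t)) A =
    (\<integral>h. (\<Sum>u<n. measure_pmf.prob (S n h u) {v. h @ [(u, v)] \<in> A}) / n \<partial>measure_pmf (hist_dist S n t))"
proof -
  have "measure_pmf.prob (bind_pmf (S n h u) (\<lambda>v. return_pmf (h @ [(u, v)]))) A
      = measure_pmf.prob (S n h u) {v. h @ [(u, v)] \<in> A}" for h u
    by (simp add: vimage_def flip: map_pmf_def)
  then show ?thesis
    using assms by (simp add: prob_bind_pmf integral_pmf_of_set lessThan_empty_iff)
qed

text \<open>\<open>B h\<close> holds the k squares that destroy \<open>Q1\<close>;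
  \<open>c h\<close> is the one square that can lead from \<open>Q2\<close> to \<open>Q\<close>. The
  assumption on \<open>Q\<close> covers every circle v, so the player has no influence and only the
  uniform square counts. \<open>Q1\<close> and \<open>Q2\<close> may overlap because the two
  contributions are simply added.\<close>

lemma prob_step_le:
  assumes S: "valid_strategy S" and n: "0 < n" and k: "k \<le> n"
    and Q: "\<And>h u v. h \<in> set_pmf (hist_dist S n t) \<Longrightarrow> u < n \<Longrightarrow> v < n \<Longrightarrow> Q (h @ [(u, v)]) \<Longrightarrow>
      (Q1 h \<and> u \<notin> B h) \<or> (Q2 h \<and> u = c h)"
    and B: "\<And>h. h \<in> set_pmf (hist_dist S n t) \<Longrightarrow> Q1 h \<Longrightarrow> B h \<subseteq> {..<n} \<and> card (B h) = k"
  shows "measure_pmf.prob (hist_dist S n (Suc t)) {h. Q h} \<le>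
    (1 - real k / real n) * measure_pmf.prob (hist_dist S n t) {h. Q1 h}
    + 1 / real n * measure_pmf.prob (hist_dist S n t) {h. Q2 h}"
proof -
  let ?H = "hist_dist S n t"
  have int: "integrable (measure_pmf ?H) (\<lambda>h. a * indicator A h)" for A and a :: real
    by (intro measure_pmf.integrable_const_bound[where B = "\<bar>a\<bar>"]) (auto simp: indicator_def)
  have bound: "(\<Sum>u<n. measure_pmf.prob (S n h u) {v. h @ [(u, v)] \<in> {h. Q h}}) / real n
      \<le> (1 - real k / real n) * indicator {h. Q1 h} h + 1 / real n * indicator {h. Q2 h} h"
    if h: "h \<in> set_pmf ?H" for h
  proof -
    have "measure_pmf.prob (S n h u) {v. h @ [(u, v)] \<in> {h. Q h}} \<le>
        of_bool (Q1 h \<and> u \<notin> B h) + of_bool (Q2 h \<and> u = c h)" if u: "u < n" for u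
    proof (cases "(Q1 h \<and> u \<notin> B h) \<or> (Q2 h \<and> u = c h)")
      case True
      have "measure_pmf.prob (S n h u) {v. h @ [(u, v)] \<in> {h. Q h}} \<le> 1"
        by (rule measure_pmf.prob_le_1)
      also have "1 \<le> of_bool (Q1 h \<and> u \<notin> B h) + (of_bool (Q2 h \<and> u = c h) :: real)"
        using True by auto
      finally show ?thesis .
    next
      case False
      have "set_pmf (S n h u) \<subseteq> {..<n}"
        using S n by (auto simp: valid_strategy_def)
      then have "set_pmf (S n h u) \<inter> {v. h @ [(u, v)] \<in> {h. Q h}} = {}"
        using Q[OF h u] False by auto
      then have "measure_pmf.prob (S n h u) {v. h @ [(u, v)] \<in> {h. Q h}} = 0"
        by (simp only: measure_pmf_zero_iff)
      then show ?thesis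
        by simp
    qed
    then have "(\<Sum>u<n. measure_pmf.prob (S n h u) {v. h @ [(u, v)] \<in> {h. Q h}}) \<le>
        (\<Sum>u<n. of_bool (Q1 h \<and> u \<notin> B h) + of_bool (Q2 h \<and> u = c h))"
      by (intro sum_mono) auto
    also have "\<dots> = (\<Sum>u<n. of_bool (Q1 h \<and> u \<notin> B h)) + (\<Sum>u<n. of_bool (Q2 h \<and> u = c h))"
      by (rule sum.distrib)
    also have "(\<Sum>u<n. of_bool (Q1 h \<and> u \<notin> B h)) = (real n - k) * of_bool (Q1 h)"
    proof (cases "Q1 h")
      case True
      have "(\<Sum>u<n. of_bool (u \<notin> B h)) = real (card ({..<n} - B h))"
        by (simp add: sum.If_cases of_bool_def Diff_eq Compl_eq)
      also have "\<dots> = real n - k"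
        using B[OF h True] k by (subst card_Diff_subset) (auto intro: finite_subset simp: of_nat_diff)
      finally show ?thesis using True by simp
    qed simp
    also have "(\<Sum>u<n. of_bool (Q2 h \<and> u = c h)) \<le> (of_bool (Q2 h) :: real)"
      by (cases "Q2 h") (simp_all add: of_bool_def)
    finally show ?thesis
      using n by (simp add: field_simps indicator_def of_bool_def split: if_splits)
  qed
  have "measure_pmf.prob (hist_dist S n (Suc t)) {h. Q h} \<le>
      (\<integral>h. (1 - real k / real n) * indicator {h. Q1 h} h + 1 / real n * indicator {h. Q2 h} h \<partial>measure_pmf ?H)"
    unfolding prob_hist_dist_Suc[OF n]
  proof (rule integral_mono_AE)
    show "integrable (measure_pmf ?H)
        (\<lambda>h. (\<Sum>u<n. measure_pmf.prob (S n h u) {v. h @ [(u, v)] \<in> {h. Q h}}) / real n)"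
    proof (rule measure_pmf.integrable_const_bound[where B = 1])
      have "(\<Sum>u<n. measure_pmf.prob (S n h u) {v. h @ [(u, v)] \<in> {h. Q h}}) \<le> (\<Sum>u<n. 1)" for h
        by (intro sum_mono) simp
      then show "AE h in measure_pmf ?H. norm ((\<Sum>u<n. measure_pmf.prob (S n h u) {v. h @ [(u, v)] \<in> {h. Q h}}) / real n) \<le> 1"
        using n by (simp add: sum_nonneg field_simps)
    qed simp
    show "AE h in measure_pmf ?H. (\<Sum>u<n. measure_pmf.prob (S n h u) {v. h @ [(u, v)] \<in> {h. Q h}}) / real n
        \<le> (1 - real k / real n) * indicator {h. Q1 h} h + 1 / real n * indicator {h. Q2 h} h"
      using bound by (simp add: AE_measure_pmf_iff)
  qed (intro Bochner_Integration.integrable_add int)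
  also have "\<dots> = (1 - real k / real n) * measure_pmf.prob ?H {h. Q1 h} + 1 / real n * measure_pmf.prob ?H {h. Q2 h}"
    by (subst Bochner_Integration.integral_add[OF int int]) simp
  finally show ?thesis .
qed

text \<open>\<open>tau_S\<close> takes the least successful time; monotonicity lets an estimate at
  one time exclude all earlier ones.\<close>

lemma prob_PM_mono:
  assumes n: "0 < n" and "s \<le> t"
  shows "prob_PM S n s \<le> prob_PM S n t"
proof (rule lift_Suc_mono_le[of "prob_PM S n", OF _ \<open>s \<le> t\<close>])
  fix t
  let ?A = "{h. has_PM n (graph_edges h)}"
  let ?f = "\<lambda>h. (\<Sum>u<n. measure_pmf.prob (S n h u) {v. h @ [(u, v)] \<in> ?A}) / n"
  have up: "h @ [e] \<in> ?A" if "h \<in> ?A" for h e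
  proof -
    have "graph_edges h \<subseteq> graph_edges (h @ [e])"
      by (auto simp: graph_edges_def)
    then show ?thesis
      using that unfolding has_PM_def mem_Collect_eq by (meson order_trans)
  qed
  have "(\<integral>h. indicator ?A h \<partial>measure_pmf (hist_dist S n t)) \<le> (\<integral>h. ?f h \<partial>measure_pmf (hist_dist S n t))"
  proof (rule integral_mono)
    have "(\<Sum>u<n. measure_pmf.prob (S n h u) {v. h @ [(u, v)] \<in> ?A}) \<le> (\<Sum>u<n. 1)" for h
      by (intro sum_mono) simp
    then show "integrable (hist_dist S n t) ?f"
      using n by (intro measure_pmf.integrable_const_bound[where B = 1]) (simp_all add: sum_nonneg field_simps)
    show "indicator ?A h \<le> ?f h" for h
    proof (cases "h \<in> ?A")
      case True
      have all: "{v. h @ [(u, v)] \<in> ?A} = UNIV" for u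
        using up[OF True] by blast
      show ?thesis
        unfolding all using n True by simp
    qed (simp add: sum_nonneg)
  qed (auto intro!: measure_pmf.integrable_const_bound[where B = 1] simp: indicator_def)
  then show "prob_PM S n t \<le> prob_PM S n (Suc t)"
    unfolding prob_PM_def prob_hist_dist_Suc[OF n] by simp
qed

section \<open>Distribution of the status of a vertex\<close>

definition status_prob :: "strategy \<Rightarrow> nat \<Rightarrow> nat \<Rightarrow> nat \<Rightarrow> (status \<Rightarrow> bool) \<Rightarrow> real" where
  "status_prob S n x t Q = measure_pmf.prob (hist_dist S n t) {h. Q (status x (map deloop h))}"

text \<open>The part of the invariant visible in the status alone. It makes the destroying squares
  x, y (and z) distinct vertices below n, so that their number is exactly 2 or 3.\<close>

definition status_wf :: "nat \<Rightarrow> nat \<Rightarrow> status \<Rightarrow> bool" where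
  "status_wf n x s \<longleftrightarrow> (case s of Fresh y \<Rightarrow> y < n \<and> y \<noteq> x | Closed y \<Rightarrow> y < n \<and> y \<noteq> x
     | Half y z \<Rightarrow> y < n \<and> z < n \<and> y \<noteq> x \<and> z \<noteq> x \<and> z \<noteq> y | _ \<Rightarrow> True)"

lemma status_wf_status: "loopless n h \<Longrightarrow> status_wf n x (status x h)"
  using status_invariant[of n h x] by (cases "status x h") (auto simp: status_wf_def)

context
  fixes S :: strategy and n x :: nat
  assumes S: "valid_strategy S" and n: "3 \<le> n" and x: "x < n"
begin

lemma status_prob_step:
  assumes "k \<le> n" and "a = real k"
    and Q: "\<And>s u v. Q (status_step x s (u, v)) \<Longrightarrow> (Q1 s \<and> u \<notin> B s) \<or> (Q2 s \<and> u = c s)"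
    and B: "\<And>s. status_wf n x s \<Longrightarrow> Q1 s \<Longrightarrow> B s \<subseteq> {..<n} \<and> card (B s) = k"
  shows "status_prob S n x (Suc t) Q \<le>
    (1 - a / n) * status_prob S n x t Q1 + 1 / n * status_prob S n x t Q2"
  unfolding status_prob_def \<open>a = real k\<close>
proof (rule prob_step_le[OF S, where B = "\<lambda>h. B (status x (map deloop h))" and c = "\<lambda>h. c (status x (map deloop h))"])
  show "0 < n" "k \<le> n"
    using n assms(1) by auto
  show "(Q1 (status x (map deloop h)) \<and> u \<notin> B (status x (map deloop h))) \<or>
      (Q2 (status x (map deloop h)) \<and> u = c (status x (map deloop h)))"
    if "Q (status x (map deloop (h @ [(u, v)])))" for h u v
    by (rule Q[of _ u "snd (deloop (u, v))"]) (use that in simp)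
next
  fix h assume h: "h \<in> set_pmf (hist_dist S n t)" "Q1 (status x (map deloop h))"
  have "set h \<subseteq> {..<n} \<times> {..<n}"
    using hist_dist_in_range[OF S _ h(1)] n by auto
  then have "loopless n (map deloop h)"
    using n by (intro deloop_loopless) auto
  then show "B (status x (map deloop h)) \<subseteq> {..<n} \<and> card (B (status x (map deloop h))) = k"
    using B status_wf_status h(2) by blast
qed

lemma status_prob_0: "status_prob S n x 0 Q = of_bool (Q Unhit)"
  by (simp add: status_prob_def)

lemma prob_Unhit_le: "status_prob S n x t (\<lambda>s. s = Unhit) \<le> (1 - 1 / n) ^ t"
proof (induction t)
  case (Suc t)
  have "status_prob S n x (Suc t) (\<lambda>s. s = Unhit) \<le>
      (1 - 1 / n) * status_prob S n x t (\<lambda>s. s = Unhit) + 1 / n * status_prob S n x t (\<lambda>s. False)"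
  proof (rule status_prob_step[where k = 1 and B = "\<lambda>_. {x}"])
    show "status_step x s (u, v) = Unhit \<Longrightarrow> s = Unhit \<and> u \<notin> {x} \<or> False \<and> u = undefined" for s u v
      by (cases s) (auto split: if_splits)
  qed (use n x in auto)
  also have "\<dots> = (1 - 1 / n) * status_prob S n x t (\<lambda>s. s = Unhit)"
    by (simp add: status_prob_def)
  also have "\<dots> \<le> (1 - 1 / n) * (1 - 1 / n) ^ t"
    using n Suc by (intro mult_left_mono) auto
  finally show ?case by simp
qed (simp add: status_prob_0)

text \<open>The binomial probability of exactly one hit; the power t - 1 is written as the power t
  divided by the base, which avoids natural subtraction.\<close>

lemma prob_once_le:
  "status_prob S n x t (\<lambda>s. s \<noteq> Unhit \<and> s \<noteq> Multi) \<le> t / n * (1 - 1 / n) ^ t / (1 - 1 / n)"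
proof (induction t)
  case (Suc t)
  let ?p = "1 - 1 / real n"
  have p: "0 < ?p" using n by simp
  have "status_prob S n x (Suc t) (\<lambda>s. s \<noteq> Unhit \<and> s \<noteq> Multi) \<le>
      (1 - 1 / n) * status_prob S n x t (\<lambda>s. s \<noteq> Unhit \<and> s \<noteq> Multi)
      + 1 / n * status_prob S n x t (\<lambda>s. s = Unhit)"
  proof (rule status_prob_step[where k = 1 and B = "\<lambda>_. {x}" and c = "\<lambda>_. x"])
    show "status_step x s (u, v) \<noteq> Unhit \<and> status_step x s (u, v) \<noteq> Multi \<Longrightarrow>
        (s \<noteq> Unhit \<and> s \<noteq> Multi) \<and> u \<notin> {x} \<or> s = Unhit \<and> u = x" for s u v
      by (cases s) (auto split: if_splits)
  qed (use n x in auto)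
  also have "\<dots> \<le> ?p * (t / n * ?p ^ t / ?p) + 1 / n * ?p ^ t"
    by (intro add_mono mult_left_mono Suc prob_Unhit_le) (use p in auto)
  also have "\<dots> = Suc t / n * ?p ^ Suc t / ?p"
    using p n by (simp add: add_divide_distrib distrib_right)
  finally show ?case .
qed (simp add: status_prob_0)

text \<open>Upper bounds for the other states cannot be subtracted from 1, so this absorbing state
  gets its own recurrence: no square destroys it, and only the square x enters it.\<close>

lemma prob_Multi_le:
  "status_prob S n x t (\<lambda>s. s = Multi) \<le> 1 - (1 - 1 / n) ^ t - t / n * (1 - 1 / n) ^ t / (1 - 1 / n)"
proof (induction t)
  case (Suc t)
  let ?p = "1 - 1 / real n"
  have p: "0 < ?p" using n by simp
  have factor: "A - K + c * K = A - (1 - c) * K" for A K c :: real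
    by (simp add: algebra_simps)
  have "status_prob S n x (Suc t) (\<lambda>s. s = Multi) \<le>
      (1 - 0 / n) * status_prob S n x t (\<lambda>s. s = Multi)
      + 1 / n * status_prob S n x t (\<lambda>s. s \<noteq> Unhit \<and> s \<noteq> Multi)"
  proof (rule status_prob_step[where k = 0 and B = "\<lambda>_. {}" and c = "\<lambda>_. x"])
    show "status_step x s (u, v) = Multi \<Longrightarrow>
        s = Multi \<and> u \<notin> {} \<or> (s \<noteq> Unhit \<and> s \<noteq> Multi) \<and> u = x" for s u v
      by (cases s) (auto split: if_splits)
  qed (use n x in auto)
  also have "\<dots> \<le> (1 - ?p ^ t - t / n * ?p ^ t / ?p) + 1 / n * (t / n * ?p ^ t / ?p)"
    using Suc by (intro add_mono mult_left_mono prob_once_le) auto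
  also have "\<dots> = 1 - ?p ^ t - ?p * (t / n * ?p ^ t / ?p)"
    by (rule factor)
  also have "\<dots> = 1 - ?p ^ t - t / n * ?p ^ t"
    using p n by simp
  also have "\<dots> = 1 - ?p ^ Suc t - Suc t / n * ?p ^ t"
    by (simp add: algebra_simps add_divide_distrib)
  also have "\<dots> = 1 - ?p ^ Suc t - Suc t / n * ?p ^ Suc t / ?p"
    using p n by simp
  finally show ?case .
qed (simp add: status_prob_0)

text \<open>The recurrence is the discrete form of F' = -2F + e^(-b) with F(0) = 0, solved by e^(-b)
  - e^(-2b). Replacing e^(-kb) by (1 - k/n)^t solves the discrete recurrence exactly.\<close>

lemma prob_Fresh_le: "status_prob S n x t (\<lambda>s. \<exists>y. s = Fresh y) \<le> (1 - 1 / n) ^ t - (1 - 2 / n) ^ t"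
proof (induction t)
  case (Suc t)
  let ?p = "1 - 1 / real n" and ?q = "1 - 2 / real n"
  have q: "0 < ?q" using n by simp
  have "status_prob S n x (Suc t) (\<lambda>s. \<exists>y. s = Fresh y) \<le>
      (1 - 2 / n) * status_prob S n x t (\<lambda>s. \<exists>y. s = Fresh y)
      + 1 / n * status_prob S n x t (\<lambda>s. s = Unhit)"
  \<comment> \<open>The incomplete \<open>case\<close> is harmless: its value matters only together
    with \<open>Q1\<close>, where the status is \<open>Fresh\<close>.\<close>
  proof (rule status_prob_step[where k = 2 and B = "\<lambda>s. case s of Fresh y \<Rightarrow> {x, y}" and c = "\<lambda>_. x"])
    show "\<exists>y. status_step x s (u, v) = Fresh y \<Longrightarrow>
        (\<exists>y. s = Fresh y) \<and> u \<notin> (case s of Fresh y \<Rightarrow> {x, y}) \<or> s = Unhit \<and> u = x" for s u v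
      by (cases s) (auto split: if_splits)
  qed (use n x in \<open>auto simp: status_wf_def\<close>)
  also have "\<dots> \<le> ?q * (?p ^ t - ?q ^ t) + 1 / n * ?p ^ t"
    by (intro add_mono mult_left_mono Suc prob_Unhit_le) (use q in auto)
  also have "\<dots> = ?p ^ Suc t - ?q ^ Suc t"
    by (simp add: algebra_simps)
  finally show ?case .
qed (simp add: status_prob_0)

text \<open>Discrete form of H' = -3H + F. The inflow is only bounded above, since a circle v = x
  leads from \<open>Fresh\<close> to \<open>Lost\<close> instead.\<close>

lemma prob_Half_le:
  "status_prob S n x t (\<lambda>s. \<exists>y z. s = Half y z) \<le>
     ((1 - 1 / n) ^ t - 2 * (1 - 2 / n) ^ t + (1 - 3 / n) ^ t) / 2"
proof (induction t)
  case (Suc t)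
  let ?p = "1 - 1 / real n" and ?q = "1 - 2 / real n" and ?r = "1 - 3 / real n"
  have r: "0 \<le> ?r" using n by simp
  have "status_prob S n x (Suc t) (\<lambda>s. \<exists>y z. s = Half y z) \<le>
      (1 - 3 / n) * status_prob S n x t (\<lambda>s. \<exists>y z. s = Half y z)
      + 1 / n * status_prob S n x t (\<lambda>s. \<exists>y. s = Fresh y)"
  proof (rule status_prob_step[where k = 3 and B = "\<lambda>s. case s of Half y z \<Rightarrow> {x, y, z}"
        and c = "\<lambda>s. case s of Fresh y \<Rightarrow> y"])
    show "\<exists>y z. status_step x s (u, v) = Half y z \<Longrightarrow>
        (\<exists>y z. s = Half y z) \<and> u \<notin> (case s of Half y z \<Rightarrow> {x, y, z}) \<or>
        (\<exists>y. s = Fresh y) \<and> u = (case s of Fresh y \<Rightarrow> y)" for s u v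
      by (cases s) (auto split: if_splits)
  qed (use n x in \<open>auto simp: status_wf_def\<close>)
  also have "\<dots> \<le> ?r * ((?p ^ t - 2 * ?q ^ t + ?r ^ t) / 2) + 1 / n * (?p ^ t - ?q ^ t)"
    by (intro add_mono mult_left_mono Suc prob_Fresh_le) (use r in auto)
  also have "\<dots> = (?p ^ Suc t - 2 * ?q ^ Suc t + ?r ^ Suc t) / 2"
    by (simp add: algebra_simps add_divide_distrib diff_divide_distrib)
  finally show ?case .
qed (simp add: status_prob_0)

text \<open>Discrete form of C' = -2C + H. The term -e^(-2b) of H decays at the same rate as C; this
  resonance produces -b e^(-2b), here the term with the factor t / n.\<close>

lemma prob_Closed_le:
  "status_prob S n x t (\<lambda>s. \<exists>y. s = Closed y) \<le>
     ((1 - 1 / n) ^ t - (1 - 3 / n) ^ t) / 2 - t / n * (1 - 2 / n) ^ t / (1 - 2 / n)"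
proof (induction t)
  case (Suc t)
  let ?p = "1 - 1 / real n" and ?q = "1 - 2 / real n" and ?r = "1 - 3 / real n"
  have q: "0 < ?q" using n by simp
  have cancel: "?q * (A - K / ?q) = ?q * A - K" for A K
    using q n by (simp add: right_diff_distrib)
  have "status_prob S n x (Suc t) (\<lambda>s. \<exists>y. s = Closed y) \<le>
      (1 - 2 / n) * status_prob S n x t (\<lambda>s. \<exists>y. s = Closed y)
      + 1 / n * status_prob S n x t (\<lambda>s. \<exists>y z. s = Half y z)"
  proof (rule status_prob_step[where k = 2 and B = "\<lambda>s. case s of Closed y \<Rightarrow> {x, y}"
        and c = "\<lambda>s. case s of Half y z \<Rightarrow> z"])
    show "\<exists>y. status_step x s (u, v) = Closed y \<Longrightarrow>
        (\<exists>y. s = Closed y) \<and> u \<notin> (case s of Closed y \<Rightarrow> {x, y}) \<or>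
        (\<exists>y z. s = Half y z) \<and> u = (case s of Half y z \<Rightarrow> z)" for s u v
      by (cases s) (auto split: if_splits)
  qed (use n x in \<open>auto simp: status_wf_def\<close>)
  also have "\<dots> \<le> ?q * ((?p ^ t - ?r ^ t) / 2 - t / n * ?q ^ t / ?q)
      + 1 / n * ((?p ^ t - 2 * ?q ^ t + ?r ^ t) / 2)"
    by (intro add_mono mult_left_mono Suc prob_Half_le) (use q in auto)
  also have "\<dots> = ?q * ((?p ^ t - ?r ^ t) / 2) - t / n * ?q ^ t
      + 1 / n * ((?p ^ t - 2 * ?q ^ t + ?r ^ t) / 2)"
    by (simp only: cancel)
  also have "\<dots> = (?p ^ Suc t - ?r ^ Suc t) / 2 - Suc t / n * ?q ^ t"
    by (simp add: algebra_simps add_divide_distrib diff_divide_distrib)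
  also have "\<dots> = (?p ^ Suc t - ?r ^ Suc t) / 2 - Suc t / n * ?q ^ Suc t / ?q"
    using q n by simp
  finally show ?case .
qed (simp add: status_prob_0)

end

text \<open>The sum of the bounds for \<open>Multi\<close>, \<open>Fresh\<close> and
  \<open>Closed\<close>, after (1 - 1/n)^t cancels between the first two.\<close>

definition good_bound :: "nat \<Rightarrow> nat \<Rightarrow> real" where
  "good_bound n t = 1 - t / n * (1 - 1 / n) ^ t / (1 - 1 / n) - (1 - 2 / n) ^ t
     + ((1 - 1 / n) ^ t - (1 - 3 / n) ^ t) / 2 - t / n * (1 - 2 / n) ^ t / (1 - 2 / n)"

lemma prob_good_le:
  assumes "valid_strategy S" "3 \<le> n" "x < n"
  shows "status_prob S n x t status_good \<le> good_bound n t"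
proof -
  let ?\<mu> = "measure_pmf.prob (hist_dist S n t)"
  let ?st = "\<lambda>h. status x (map deloop h)"
  have "status_good s \<longleftrightarrow> s = Multi \<or> (\<exists>y. s = Fresh y) \<or> (\<exists>y. s = Closed y)" for s
    by (cases s) auto
  then have "status_prob S n x t status_good =
      ?\<mu> ({h. ?st h = Multi} \<union> ({h. \<exists>y. ?st h = Fresh y} \<union> {h. \<exists>y. ?st h = Closed y}))"
    unfolding status_prob_def by (intro arg_cong[where f = ?\<mu>]) auto
  also have "\<dots> \<le> ?\<mu> {h. ?st h = Multi} + ?\<mu> ({h. \<exists>y. ?st h = Fresh y} \<union> {h. \<exists>y. ?st h = Closed y})"
    by (intro measure_Un_le) auto
  also have "\<dots> \<le> ?\<mu> {h. ?st h = Multi} + (?\<mu> {h. \<exists>y. ?st h = Fresh y} + ?\<mu> {h. \<exists>y. ?st h = Closed y})"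
    by (intro add_left_mono measure_Un_le) auto
  also have "\<dots> \<le> good_bound n t"
    using prob_Multi_le[OF assms, of t] prob_Fresh_le[OF assms, of t] prob_Closed_le[OF assms, of t]
    by (simp add: status_prob_def good_bound_def)
  finally show ?thesis .
qed

text \<open>Markov's inequality for the number of good vertices, whose expectation is at most n
  times \<open>good_bound n t\<close>.\<close>

lemma prob_PM_le:
  assumes S: "valid_strategy S" and n: "3 \<le> n"
  shows "prob_PM S n t \<le> real n / real (n div 2) * good_bound n t"
proof -
  let ?H = "hist_dist S n t"
  let ?good = "\<lambda>x. {h. status_good (status x (map deloop h))}"
  have int: "integrable (measure_pmf ?H) (\<lambda>h. c * indicator A h)" for A and c :: real
    by (intro measure_pmf.integrable_const_bound[where B = "\<bar>c\<bar>"]) (auto simp: indicator_def)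
  have int': "integrable (measure_pmf ?H) (indicator A :: _ \<Rightarrow> real)" for A
    using int[of 1 A] by simp
  have "real (n div 2) * prob_PM S n t = (\<integral>h. real (n div 2) * indicator {h. has_PM n (graph_edges h)} h \<partial>measure_pmf ?H)"
    by (simp add: prob_PM_def)
  also have "\<dots> \<le> (\<integral>h. (\<Sum>x<n. indicator (?good x) h) \<partial>measure_pmf ?H)"
  proof (rule integral_mono_AE)
    show "AE h in measure_pmf ?H. real (n div 2) * indicator {h. has_PM n (graph_edges h)} h \<le> (\<Sum>x<n. indicator (?good x) h)"
    proof (simp only: AE_measure_pmf_iff, intro ballI)
      fix h assume "h \<in> set_pmf ?H"
      then have h: "set h \<subseteq> {..<n} \<times> {..<n}"
        using S n by (intro hist_dist_in_range) auto
      have "(\<Sum>x<n. indicator (?good x) h) = real (card {x. x < n \<and> status_good (status x (map deloop h))})"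
        by (simp add: indicator_def sum.If_cases lessThan_def Int_def)
      then show "real (n div 2) * indicator {h. has_PM n (graph_edges h)} h \<le> (\<Sum>x<n. indicator (?good x) h :: real)"
        using has_PM_imp_good[OF _ h] n by (simp add: indicator_def)
    qed
  qed (auto intro: int int')
  also have "\<dots> = (\<Sum>x<n. status_prob S n x t status_good)"
    by (subst Bochner_Integration.integral_sum) (auto intro: int' simp: status_prob_def)
  also have "\<dots> \<le> (\<Sum>x<n. good_bound n t)"
    using prob_good_le[OF S n] by (intro sum_mono) auto
  finally show ?thesis
    using n by (simp add: field_simps)
qed

section \<open>Asymptotics\<close>

lemma tendsto_floor_div:
  assumes "0 \<le> b"
  shows "(\<lambda>n. real (nat \<lfloor>b * real n\<rfloor>) / real n) \<longlonglongrightarrow> b"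
proof (rule tendsto_sandwich)
  have bounds: "b * real n - 1 \<le> real (nat \<lfloor>b * real n\<rfloor>) \<and> real (nat \<lfloor>b * real n\<rfloor>) \<le> b * real n" for n
    using assms by (simp add: of_nat_nat)
  show "\<forall>\<^sub>F n in sequentially. b - 1 / real n \<le> real (nat \<lfloor>b * real n\<rfloor>) / real n"
    using eventually_gt_at_top[of 0]
  proof eventually_elim
    case (elim n)
    then have "b - 1 / real n = (b * real n - 1) / real n"
      by (simp add: field_simps)
    also have "\<dots> \<le> real (nat \<lfloor>b * real n\<rfloor>) / real n"
      using bounds by (intro divide_right_mono) auto
    finally show ?case .
  qed
  show "\<forall>\<^sub>F n in sequentially. real (nat \<lfloor>b * real n\<rfloor>) / real n \<le> b"
    using eventually_gt_at_top[of 0] by eventually_elim (use bounds in \<open>simp add: field_simps\<close>)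
  show "(\<lambda>n. b - 1 / real n) \<longlonglongrightarrow> b"
    using tendsto_diff[OF tendsto_const lim_1_over_n, of b] by simp
qed simp

lemma tendsto_power_floor_exp:
  assumes "0 \<le> b"
  shows "(\<lambda>n. (1 - k / real n) ^ nat \<lfloor>b * real n\<rfloor>) \<longlonglongrightarrow> exp (- k * b)"
proof -
  \<comment> \<open>The power is rewritten as (1 - k/n)^n raised to the real exponent floor(bn)/n.
    This needs a positive base, hence n > |k| below.\<close>
  have lim: "(\<lambda>n. ((1 + - k / real n) ^ n) powr (real (nat \<lfloor>b * real n\<rfloor>) / real n)) \<longlonglongrightarrow> exp (- k) powr b"
    by (intro tendsto_powr tendsto_exp_limit_sequentially tendsto_floor_div assms) auto
  have lim_eq: "exp (- k) powr b = exp (- k * b)"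
    by (simp add: exp_powr_real)
  have "\<forall>\<^sub>F n in sequentially. ((1 + - k / real n) ^ n) powr (real (nat \<lfloor>b * real n\<rfloor>) / real n)
      = (1 - k / real n) ^ nat \<lfloor>b * real n\<rfloor>"
    using eventually_gt_at_top[of "nat \<lceil>\<bar>k\<bar>\<rceil>"]
  proof eventually_elim
    case (elim n)
    then have n: "\<bar>k\<bar> < real n" by linarith
    then have "0 < 1 - k / real n" by (simp add: field_simps)
    with n show ?case
      by (simp add: powr_powr flip: powr_realpow)
  qed
  then show ?thesis
    by (rule Lim_transform_eventually[OF lim[unfolded lim_eq]])
qed

lemma tendsto_div_half: "(\<lambda>n. real n / real (n div 2)) \<longlonglongrightarrow> 2"
proof -
  have "(\<lambda>n. real (n div 2) / real n) \<longlonglongrightarrow> 1 / 2"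
    using tendsto_floor_div[of "1 / 2"] by (simp add: floor_divide_of_nat_eq[of _ 2, simplified])
  then have "(\<lambda>n. inverse (real (n div 2) / real n)) \<longlonglongrightarrow> inverse (1 / 2)"
    by (intro tendsto_inverse) auto
  then show ?thesis by simp
qed

lemma tendsto_good_bound:
  assumes "0 \<le> b"
  shows "(\<lambda>n. good_bound n (nat \<lfloor>b * real n\<rfloor>)) \<longlonglongrightarrow> g_fun b"
proof -
  have one: "(\<lambda>n. 1 - k / real n) \<longlonglongrightarrow> 1" for k
    using tendsto_diff[OF tendsto_const tendsto_mult[OF tendsto_const lim_1_over_n], of 1 k] by simp
  have "(\<lambda>n. good_bound n (nat \<lfloor>b * real n\<rfloor>)) \<longlonglongrightarrow>
      1 - b * exp (- 1 * b) / 1 - exp (- 2 * b) + (exp (- 1 * b) - exp (- 3 * b)) / 2 - b * exp (- 2 * b) / 1"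
    unfolding good_bound_def
    by (intro tendsto_intros tendsto_floor_div tendsto_power_floor_exp one assms) auto
  also have "1 - b * exp (- 1 * b) / 1 - exp (- 2 * b) + (exp (- 1 * b) - exp (- 3 * b)) / 2
      - b * exp (- 2 * b) / 1 = g_fun b"
    by (simp add: g_fun_def algebra_simps diff_divide_distrib)
  finally show ?thesis .
qed

section \<open>The threshold\<close>

text \<open>The estimate of \<open>prob_PM\<close> is the same for all strategies, so one threshold
  for n serves them all and the bound passes to the infimum.\<close>

lemma tau_qn_ge:
  assumes b: "0 \<le> b" and q: "2 * g_fun b < q"
  shows "\<forall>\<^sub>F n in sequentially. ereal b \<le> tau_qn q n / ereal (real n)"
proof -
  have "(\<lambda>n. real n / real (n div 2) * good_bound n (nat \<lfloor>b * real n\<rfloor>)) \<longlonglongrightarrow> 2 * g_fun b"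
    by (intro tendsto_mult tendsto_div_half tendsto_good_bound b)
  then have "\<forall>\<^sub>F n in sequentially. real n / real (n div 2) * good_bound n (nat \<lfloor>b * real n\<rfloor>) < q"
    using q by (rule order_tendstoD)
  then show ?thesis
    using eventually_ge_at_top[of 3]
  proof eventually_elim
    case (elim n)
    have "ereal (b * real n) \<le> tau_S S q n" if S: "valid_strategy S" for S
    proof (cases "\<exists>t. q \<le> prob_PM S n t")
      case True
      define m where "m = (LEAST t. q \<le> prob_PM S n t)"
      have "q \<le> prob_PM S n m"
        unfolding m_def using True by (rule LeastI_ex)
      moreover have "prob_PM S n (nat \<lfloor>b * real n\<rfloor>) < q"
        using prob_PM_le[OF S] elim by (meson le_less_trans)
      ultimately have "\<not> m \<le> nat \<lfloor>b * real n\<rfloor>"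
        using prob_PM_mono[of n m "nat \<lfloor>b * real n\<rfloor>" S] elim by linarith
      then have "b * real n \<le> real m"
        by linarith
      then show ?thesis
        using True by (simp add: tau_S_def m_def)
    qed (simp add: tau_S_def)
    then have "ereal (b * real n) \<le> tau_qn q n"
      unfolding tau_qn_def by (intro INF_greatest) auto
    then have "ereal (b * real n) / ereal (real n) \<le> tau_qn q n / ereal (real n)"
      using elim by (intro ereal_divide_right_mono) auto
    then show ?case
      using elim by simp
  qed
qed

lemma tau_qn_mono:
  assumes "q \<le> q'"
  shows "tau_qn q n \<le> tau_qn q' n"
proof -
  have "tau_S S q n \<le> tau_S S q' n" for S
  proof (cases "\<exists>t. q' \<le> prob_PM S n t")
    case True
    then have "q' \<le> prob_PM S n (LEAST t. q' \<le> prob_PM S n t)"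
      by (rule LeastI_ex)
    then have "q \<le> prob_PM S n (LEAST t. q' \<le> prob_PM S n t)"
      using assms by simp
    then show ?thesis
      using True by (auto simp: tau_S_def intro: Least_le)
  qed (simp add: tau_S_def)
  then show ?thesis
    unfolding tau_qn_def by (intro INF_mono) auto
qed

lemma tendsto_at_left_SUP:
  fixes f :: "real \<Rightarrow> ereal"
  assumes "mono f"
  shows "(f \<longlongrightarrow> (SUP x\<in>{..<a}. f x)) (at_left a)"
proof (rule increasing_tendsto)
  show "\<forall>\<^sub>F x in at_left a. f x \<le> (SUP x\<in>{..<a}. f x)"
    by (auto simp: eventually_at_filter intro!: always_eventually SUP_upper)
next
  fix l assume "l < (SUP x\<in>{..<a}. f x)"
  then obtain y where y: "y < a" "l < f y"
    by (auto simp: less_SUP_iff)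
  have "\<forall>\<^sub>F x in at_left a. y < x"
    using eventually_at_left_real[OF y(1)] by eventually_elim simp
  then show "\<forall>\<^sub>F x in at_left a. l < f x"
    by eventually_elim (use y(2) monoD[OF assms] in \<open>meson less_imp_le less_le_trans\<close>)
qed

text \<open>\<open>Lim\<close> is informative only once convergence is known; monotonicity in q
  provides it. Values q \<le> 0 do not raise the supremum, again by monotonicity.\<close>

lemma tau_PM_eq_SUP: "tau_PM = (SUP q\<in>{..<1}. limsup (\<lambda>n. tau_qn q n / ereal (real n)))"
  unfolding tau_PM_def
proof (intro tendsto_Lim tendsto_at_left_SUP monoI)
  fix q q' :: real
  assume "q \<le> q'"
  show "limsup (\<lambda>n. tau_qn q n / ereal (real n)) \<le> limsup (\<lambda>n. tau_qn q' n / ereal (real n))"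
    using eventually_gt_at_top[of 0]
    by (intro Limsup_mono, eventually_elim) (auto intro!: ereal_divide_right_mono tau_qn_mono \<open>q \<le> q'\<close>)
qed simp

lemma le_tau_PM:
  assumes "0 \<le> b" "g_fun b < 1 / 2"
  shows "ereal b \<le> tau_PM"
proof -
  \<comment> \<open>The midpoint between 2 \<open>g_fun b\<close> and 1.\<close>
  define q where "q = (2 * g_fun b + 1) / 2"
  have "q < 1" "2 * g_fun b < q"
    using assms by (simp_all add: q_def)
  have "ereal b \<le> limsup (\<lambda>n. tau_qn q n / ereal (real n))"
    using tau_qn_ge[OF assms(1) \<open>2 * g_fun b < q\<close>] by (intro le_Limsup) auto
  also have "\<dots> \<le> tau_PM"
    unfolding tau_PM_eq_SUP using \<open>q < 1\<close> by (intro SUP_upper) auto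
  finally show ?thesis .
qed

section \<open>The numerical bound\<close>

lemma g_fun_deriv:
  "(g_fun has_real_derivative
      exp (- b) * (b - 3 / 2 + (2 * b + 1) * exp (- b) + 3 / 2 * (exp (- b))\<^sup>2)) (at b)"
proof -
  have e: "exp (- (b * 2)) = exp (- b) * exp (- b)" "exp (- (b * 3)) = exp (- b) * exp (- b) * exp (- b)"
    by (simp_all flip: exp_add)
  show ?thesis
    unfolding g_fun_def[abs_def]
    by (auto intro!: derivative_eq_intros simp: e field_simps power2_eq_square)
qed

text \<open>Since \<open>alpha_PM\<close> is an infimum, \<open>g_fun\<close> must stay below 1/2 on
  the whole interval up to 0.93261; monotonicity reduces this to the endpoint.\<close>

lemma g_fun_mono:
  assumes "0 \<le> a" "a \<le> b" "b \<le> 1"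
  shows "g_fun a \<le> g_fun b"
proof (rule DERIV_nonneg_imp_nondecreasing[OF assms(2)])
  fix x assume x: "a \<le> x" "x \<le> b"
  have "0 \<le> x - 3 / 2 + (2 * x + 1) * exp (- x) + 3 / 2 * (exp (- x))\<^sup>2"
  \<comment> \<open>With e^(-x) \<ge> 1 - x the expression is at least 1 - x - x^2/2, nonnegative up
    to sqrt 3 - 1 = 0.732...; with e^(-x) \<ge> 1/3 it is at least 5x/3 - 1, nonnegative from 3/5
    on. The cut lies in between.\<close>
  proof (cases "x \<le> 7 / 10")
    case True
    have "1 - x \<le> exp (- x)"
      using exp_ge_add_one_self[of "- x"] by simp
    then have "(2 * x + 1) * (1 - x) \<le> (2 * x + 1) * exp (- x)" "(1 - x)\<^sup>2 \<le> (exp (- x))\<^sup>2"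
      using assms x by (auto intro!: mult_left_mono power_mono)
    moreover have "0 \<le> x * (7 / 10 - x)"
      using True assms x by simp
    ultimately show ?thesis
      using True by (simp add: power2_eq_square algebra_simps)
  next
    case False
    have "exp x \<le> 3"
      using exp_le exp_le_cancel_iff[of x 1] assms x by linarith
    then have "1 / 3 \<le> exp (- x)"
      by (simp add: exp_minus field_simps)
    then have "(2 * x + 1) * (1 / 3) \<le> (2 * x + 1) * exp (- x)" "(1 / 3)\<^sup>2 \<le> (exp (- x))\<^sup>2"
      using assms x by (auto intro!: mult_left_mono power_mono)
    then show ?thesis
      using False by (simp add: power2_eq_square algebra_simps)
  qed
  then show "\<exists>y. (g_fun has_real_derivative y) (at x) \<and> 0 \<le> y"
    using g_fun_deriv[of x] by auto
qed

text \<open>A Taylor polynomial of odd degree bounds exp from below; degree 11 is enough here.\<close>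

lemma g_fun_numeric: "g_fun 0.93261 < 1 / 2"
proof -
  define y where "y = exp (- 0.93261 :: real)"
  \<comment> \<open>exp(-0.93261) = 0.3935252... cut to six decimals; with five the final estimate
    would fail.\<close>
  define l :: real where "l = 0.393525"
  obtain s where "y = (\<Sum>m<12. (- 0.93261) ^ m / fact m) + exp s / fact 12 * (- 0.93261) ^ 12"
    unfolding y_def using Maclaurin_exp_le[of "- 0.93261" 12] by blast
  then have "(\<Sum>m<12. (- 0.93261) ^ m / fact m) \<le> y"
    by simp
  moreover have "l \<le> (\<Sum>m<12. (- 0.93261) ^ m / fact m)"
    by (simp add: l_def eval_nat_numeral fact_numeral lessThan_Suc)
  ultimately have y: "l \<le> y" by simp
  \<comment> \<open>All powers of y have negative coefficients, so a lower bound on y bounds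
    \<open>g_fun\<close> from above.\<close>
  have "g_fun 0.93261 = 1 - 0.43261 * y - 1.93261 * y ^ 2 - y ^ 3 / 2"
    by (simp add: g_fun_def y_def flip: exp_of_nat_mult)
  also have "\<dots> \<le> 1 - 0.43261 * l - 1.93261 * l ^ 2 - l ^ 3 / 2"
    using y by (intro diff_mono mult_left_mono divide_right_mono power_mono) (auto simp: l_def)
  also have "\<dots> < 1 / 2"
    by (simp add: l_def power2_eq_square power3_eq_cube)
  finally show ?thesis .
qed

text \<open>A witness that the set defining \<open>alpha_PM\<close> is nonempty, so that its infimum
  is meaningful.\<close>

lemma g_fun_3: "1 / 2 \<le> g_fun 3"
proof -
  have "2 \<le> exp (1 :: real)"
    using exp_ge_add_one_self[of 1] by simp
  then have "exp (- 1) \<le> (1 / 2 :: real)"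
    by (simp add: exp_minus field_simps)
  then have "exp (- 1) ^ 3 \<le> (1 / 2 :: real) ^ 3"
    by (intro power_mono) auto
  then have y: "exp (- 3) \<le> (1 / 8 :: real)"
    by (simp add: power3_eq_cube flip: exp_of_nat_mult exp_add)
  define y where "y = exp (- 3 :: real)"
  have "1 / 2 \<le> 1 - 5 / 2 * (1 / 8) - 4 * (1 / 8) ^ 2 - (1 / 8 :: real) ^ 3 / 2"
    by (simp add: power2_eq_square power3_eq_cube)
  also have "\<dots> \<le> 1 - 5 / 2 * y - 4 * y ^ 2 - y ^ 3 / 2"
    using y by (intro diff_mono mult_left_mono divide_right_mono power_mono) (auto simp: y_def)
  also have "\<dots> = g_fun 3"
    by (simp add: g_fun_def y_def flip: exp_of_nat_mult)
  finally show ?thesis .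
qed

lemma alpha_PM_ge: "0.93261 \<le> alpha_PM"
  unfolding alpha_PM_def
proof (rule cInf_greatest)
  show "{b. 0 \<le> b \<and> 1 / 2 \<le> g_fun b} \<noteq> {}"
    using g_fun_3 by force
next
  fix b assume b: "b \<in> {b. 0 \<le> b \<and> 1 / 2 \<le> g_fun b}"
  show "0.93261 \<le> b"
  proof (rule ccontr)
    assume "\<not> 0.93261 \<le> b"
    then show False
      using b g_fun_mono[of b "0.93261"] g_fun_numeric by simp
  qed
qed

lemma g_fun_less_of_less_alpha:
  assumes "0 \<le> b" "b < alpha_PM"
  shows "g_fun b < 1 / 2"
proof (rule ccontr)
  assume "\<not> g_fun b < 1 / 2"
  then have "alpha_PM \<le> b"
    unfolding alpha_PM_def using assms(1) by (intro cInf_lower bdd_belowI[of _ 0]) auto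
  with assms(2) show False by simp
qed

theorem theorem2:
  shows "tau_PM \<ge> ereal alpha_PM \<and> alpha_PM \<ge> 0.93261"
proof
  show "0.93261 \<le> alpha_PM"
    by (rule alpha_PM_ge)
  show "ereal alpha_PM \<le> tau_PM"
  \<comment> \<open>The strict inequality \<open>g_fun b < 1 / 2\<close> is available only for b
    below \<open>alpha_PM\<close>, so the bound is approached from below.\<close>
  proof (rule dense_le)
    fix c assume c: "c < ereal alpha_PM"
    show "c \<le> tau_PM"
    proof (cases "c \<le> ereal 0")
      case True
      have "ereal 0 \<le> tau_PM"
        using alpha_PM_ge by (intro le_tau_PM g_fun_less_of_less_alpha) auto
      with True show ?thesis by (rule order_trans)
    next
      case False
      with c obtain b where "c = ereal b" "0 \<le> b" "b < alpha_PM"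
        by (cases c) auto
      then show ?thesis
        using le_tau_PM g_fun_less_of_less_alpha by simp
    qed
  qed
qed

end
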